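(* Let the initial-value problem $y'(t)=\Phi(t,y(t))$, $y(0)=v$, $t\in[0,T]$, with solution $y(t)$, be given, where for every $k=0,1,2,\dots$ one has the splitting $\Phi(t,y)=-A_k y+f_k(y)+g(t)$ for all $y\in\mathbb{R}^N$, $t\ge 0$. Assume that the mappings $f_k$ are all Lipschitz continuous with a common Lipschitz constant $L$, and that there exist constants $C>0$ and $\omega\ge 0$ such that the matrices $A_k$ satisfy a common exponential bound, i.e. for all $k$ $$\|f_k(u)-f_k(w)\|\le L\|u-w\|\quad \forall u,w\in\mathbb{R}^N,\qquad \|\exp(-tA_k)\|\le Ce^{-\omega t}\quad\forall t\ge 0.$$ Let the problem be solved iteratively by nonlinear waveform relaxation: $y_0(t)$, $t\in[0,T]$, is an initial approximation to $y(t)$ with $y_0(0)=v$, and for $k=0,1,2,\dots$ the function $y_{k+1}$ is the solution of the linear initial-value problem $$y_{k+1}'(t)=-A_k y_{k+1}(t)+f_k(y_k(t))+g(t),\quad y_{k+1}(0)=v,\quad t\in[0,T].$$ Then the errors $\epsilon_k(t)=y(t)-y_k(t)$ satisfy, for $k=1,2,\dots$ and all $t\in[0,T]$, $$\|\epsilon_k(t)\|\le (CL)^k\,t^k e^{-\omega t}\varphi_k(\omega t)\max_{s\in[0,t]}\|\epsilon_0(s)\|\le (CL)^k\,\frac{t^k}{k!}\max_{s\in[0,t]}\|\epsilon_0(s)\|.$$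
   Context: $\Phi:\mathbb{R}\times\mathbb{R}^N\to\mathbb{R}^N$, $v\in\mathbb{R}^N$ and $T>0$ are given; $A_k\in\mathbb{R}^{N\times N}$; $f_k:\mathbb{R}^N\to\mathbb{R}^N$; $g:\mathbb{R}\to\mathbb{R}^N$. $\|\cdot\|$ is a vector norm in $\mathbb{C}^N$ or the corresponding induced matrix norm. The entire functions $\varphi_j$ are defined by $\varphi_0(z)=e^z$, $\varphi_{j+1}(z)=\frac{\varphi_j(z)-\varphi_j(0)}{z}$, with $\varphi_j(0)=1/j!$. *)

theory Defs
  imports "HOL-Analysis.Analysis"
begin

definition vector_norm :: "(complex ^ 'n \<Rightarrow> real) \<Rightarrow> bool" where
  "vector_norm nrm \<longleftrightarrow>
     (\<forall>x. nrm x = 0 \<longleftrightarrow> x = 0) \<and>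
     (\<forall>c x. nrm (c *s x) = cmod c * nrm x) \<and>
     (\<forall>x y. nrm (x + y) \<le> nrm x + nrm y)"

(* The supremum is over a nonempty bounded set, as all norms on C^n are equivalent. *)
definition induced_norm :: "(complex ^ 'n \<Rightarrow> real) \<Rightarrow> complex ^ 'n ^ 'n \<Rightarrow> real" where
  "induced_norm nrm M = (SUP x\<in>{x. x \<noteq> 0}. nrm (M *v x) / nrm x)"

definition cvec :: "real ^ 'n \<Rightarrow> complex ^ 'n" where
  "cvec x = (\<chi> i. complex_of_real (x $ i))"

abbreviation cmat :: "real ^ 'n ^ 'n \<Rightarrow> complex ^ 'n ^ 'n" where
  "cmat \<equiv> map_matrix complex_of_real"

(* On the type real^'n^'n the operations 1, * and ^ are componentwise, so the powers
   are taken explicitly with respect to the matrix product. *)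
definition matrix_power :: "real ^ 'n ^ 'n \<Rightarrow> nat \<Rightarrow> real ^ 'n ^ 'n" where
  "matrix_power A m = ((**) A ^^ m) (mat 1)"

definition matrix_exp :: "real ^ 'n ^ 'n \<Rightarrow> real ^ 'n ^ 'n" where
  "matrix_exp A = (\<Sum>m. (1 / fact m) *\<^sub>R matrix_power A m)"

(* Polymorphic, so that the same definition gives the entire functions on the complex
   plane and their restrictions to the real line. *)
primrec varphi :: "nat \<Rightarrow> 'a \<Rightarrow> 'a::{banach, real_normed_field}" where
  "varphi 0 = exp"
| "varphi (Suc j) =
     (\<lambda>z. if z = 0 then 1 / fact (Suc j) else (varphi j z - varphi j 0) / z)"

end

(* For e = eps_(k+1), the function s \<mapsto> exp(-(t-s)A_k) e(s) runs from 0 to e(t) on [0,t] and has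
   derivative exp(-(t-s)A_k) (f_k(y) - f_k(y_k))(s), because the A_k terms cancel. The norm of this
   derivative is at most C L exp(-\<omega>(t-s)) |eps_k(s)|, which after inserting the bound for eps_k is a
   constant multiple of s^k \<phi>_k(\<omega> s), the derivative of s^(k+1) \<phi>_(k+1)(\<omega> s). A mean value inequality
   for the given norm then yields the bound for eps_(k+1) without any integration. The second
   estimate is \<phi>_k(z) \<le> exp(z) / k! for z \<ge> 0. *)

theory Submission
  imports Defs
begin

section \<open>Mean value inequality for sublinear functions\<close>

text \<open>The epigraph of \<open>p\<close> is a closed convex cone containing the derivative of \<open>(w, \<psi>)\<close>. A functional
  separating the increment of \<open>(w, \<psi>)\<close> from it would be nonnegative on the cone, hence
  nondecreasing along the curve.\<close>

lemma seminorm_mean_value_le: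
  fixes w w' :: "real \<Rightarrow> 'a::euclidean_space" and \<psi> \<psi>' p
  assumes cont: "continuous_on UNIV p"
    and subadd: "\<And>x y. p (x + y) \<le> p x + p y"
    and homog: "\<And>r x. r \<ge> 0 \<Longrightarrow> p (r *\<^sub>R x) = r * p x"
    and "a \<le> b"
    and w: "\<And>s. s \<in> {a..b} \<Longrightarrow> (w has_vector_derivative w' s) (at s within {a..b})"
    and \<psi>: "\<And>s. s \<in> {a..b} \<Longrightarrow> (\<psi> has_real_derivative \<psi>' s) (at s within {a..b})"
    and le: "\<And>s. s \<in> {a..b} \<Longrightarrow> p (w' s) \<le> \<psi>' s"
  shows "p (w b - w a) \<le> \<psi> b - \<psi> a"
proof (rule ccontr)
  define K :: "('a \<times> real) set" where "K = {z. p (fst z) \<le> snd z}"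
  assume "\<not> ?thesis"
  then have notin: "(w b - w a, \<psi> b - \<psi> a) \<notin> K"
    by (simp add: K_def)
  have "closed K"
    unfolding K_def
    by (intro closed_Collect_le continuous_intros continuous_on_compose2[OF cont]) auto
  moreover have "convex K"
  proof (rule convexI)
    fix x y :: "'a \<times> real" and u v :: real
    assume *: "x \<in> K" "y \<in> K" "0 \<le> u" "0 \<le> v" "u + v = 1"
    have "p (fst (u *\<^sub>R x + v *\<^sub>R y)) \<le> u * p (fst x) + v * p (fst y)"
      using subadd[of "u *\<^sub>R fst x" "v *\<^sub>R fst y"] * by (simp add: homog)
    also have "\<dots> \<le> u * snd x + v * snd y"
      using * by (intro add_mono mult_left_mono) (auto simp: K_def)
    finally show "u *\<^sub>R x + v *\<^sub>R y \<in> K"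
      by (simp add: K_def)
  qed
  ultimately obtain c d where cd: "inner c (w b - w a, \<psi> b - \<psi> a) < d"
      "\<And>z. z \<in> K \<Longrightarrow> d < inner c z"
    using separating_hyperplane_closed_point[OF _ _ notin] by blast
  have scale: "r *\<^sub>R z \<in> K" if "z \<in> K" "r \<ge> 0" for r z
    using that by (simp add: K_def homog mult_left_mono)
  have "p 0 = 0"
    using homog[of 0 0] by simp
  \<comment> \<open>The origin lies in the cone, so the separating level \<open>d\<close> is
    strictly negative.\<close>
  then have "d < 0"
    using cd(2)[of 0] by (simp add: K_def)
  have nonneg: "inner c z \<ge> 0" if "z \<in> K" for z
  proof (rule ccontr)
    assume neg: "\<not> 0 \<le> inner c z"
    \<comment> \<open>The factor is chosen so that the scaled point has inner product exactly
      \<open>d\<close> with \<open>c\<close>, whereas points of \<open>K\<close> lie strictly above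
      this level.\<close>
    then have "(d / inner c z) *\<^sub>R z \<in> K"
      using \<open>d < 0\<close> that by (intro scale) (auto simp: divide_nonpos_neg)
    from cd(2)[OF this] neg show False by simp
  qed
  define q where "q = (\<lambda>s. inner c (w s, \<psi> s))"
  have "((\<lambda>s. (w s, \<psi> s)) has_vector_derivative (w' s, \<psi>' s)) (at s within {a..b})"
    if "s \<in> {a..b}" for s
    using w[OF that] \<psi>[OF that]
    by (intro has_vector_derivative_Pair) (auto simp: has_real_derivative_iff_has_vector_derivative)
  then have q: "(q has_real_derivative inner c (w' s, \<psi>' s)) (at s within {a..b})"
    if "s \<in> {a..b}" for s
    unfolding q_def has_real_derivative_iff_has_vector_derivative
    using bounded_linear.has_vector_derivative[OF bounded_linear_inner_right] that by blast
  have "q a \<le> q b"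
  proof (rule DERIV_nonneg_imp_increasing_open[OF \<open>a \<le> b\<close>])
    fix s assume s: "a < s" "s < b"
    then have "DERIV q s :> inner c (w' s, \<psi>' s)"
      using q[of s] by (simp add: at_within_Icc_at)
    moreover have "inner c (w' s, \<psi>' s) \<ge> 0"
      using le[of s] s by (intro nonneg) (simp add: K_def)
    ultimately show "\<exists>y. DERIV q s :> y \<and> 0 \<le> y" by blast
  next
    show "continuous_on {a..b} q"
      using q DERIV_continuous continuous_on_eq_continuous_within by blast
  qed
  then have "inner c (w b - w a, \<psi> b - \<psi> a) \<ge> 0"
    by (simp add: q_def inner_diff_right flip: diff_Pair)
  with cd(1) \<open>d < 0\<close> show False by simp
qed

section \<open>Derivatives and bounds for the functions \<open>varphi\<close>\<close>

lemma varphi_0: "varphi k 0 = 1 / fact k"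
  by (cases k) auto

text \<open>Clearing the denominator removes the case distinction at \<open>z = 0\<close>, where
  both sides vanish.\<close>

lemma varphi_Suc_mult: "z * varphi (Suc k) z = varphi k z - 1 / fact k"
  by (auto simp: varphi_0)

lemma power_div_fact_has_derivative:
  "((\<lambda>s::real. s ^ Suc k / fact (Suc k)) has_real_derivative s ^ k / fact k) (at s within S)"
proof -
  have "((\<lambda>s::real. s ^ Suc k / fact (Suc k)) has_real_derivative
      real (Suc k) * s ^ k / fact (Suc k)) (at s within S)"
    using DERIV_power_Suc[OF DERIV_ident, of k s S]
    by (intro DERIV_cdivide) simp
  then show ?thesis
    by (simp add: fact_Suc del: of_nat_Suc)
qed

text \<open>For \<omega> = 0 the function is a plain power over a factorial. Otherwise the recursion
  for \<open>varphi\<close> expresses it through the same function of one index less, and induction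
  applies.\<close>

lemma power_mult_varphi_has_derivative:
  fixes \<omega> s :: real
  shows "((\<lambda>s. s ^ Suc k * varphi (Suc k) (\<omega> * s)) has_real_derivative
     s ^ k * varphi k (\<omega> * s)) (at s within S)"
proof (cases "\<omega> = 0")
  case True
  show ?thesis
    using power_div_fact_has_derivative[of k s S] by (simp add: True varphi_0 del: varphi.simps)
next
  case False
  have eq: "s ^ Suc k * varphi (Suc k) (\<omega> * s) =
      (s ^ k * varphi k (\<omega> * s) - s ^ k / fact k) / \<omega>" for k s
  proof -
    have "\<omega> * (s ^ Suc k * varphi (Suc k) (\<omega> * s)) =
        s ^ k * ((\<omega> * s) * varphi (Suc k) (\<omega> * s))"
      by (simp only: power_Suc mult_ac)
    also have "\<dots> = s ^ k * varphi k (\<omega> * s) - s ^ k / fact k"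
      unfolding varphi_Suc_mult by (simp add: algebra_simps)
    finally show ?thesis
      using False by (metis nonzero_mult_div_cancel_left)
  qed
  show ?thesis
  proof (induction k)
    case 0
    show ?case
      unfolding eq by (rule derivative_eq_intros refl | simp add: False)+
  next
    case (Suc k)
    show ?case
      \<comment> \<open>The first rewriting changes the function, the second only the claimed
        derivative at the fixed point \<open>s\<close>. Both are then differences divided by
        \<omega> that match term by term.\<close>
      unfolding eq[of _ "Suc k"] unfolding eq[of s k]
      by (intro DERIV_cdivide DERIV_diff Suc.IH power_div_fact_has_derivative)
  qed
qed

text \<open>With the factor \<open>s ^ k\<close> included, both sides of the next inequality vanish
  at 0 and their derivatives can be compared by the induction hypothesis.\<close>

lemma power_mult_varphi_le:
  fixes \<omega> s :: real
  assumes "\<omega> \<ge> 0" "s \<ge> 0"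
  shows "s ^ k * varphi k (\<omega> * s) \<le> s ^ k / fact k * exp (\<omega> * s)"
  using \<open>s \<ge> 0\<close>
proof (induction k arbitrary: s)
  case 0
  then show ?case by simp
next
  case (Suc k)
  define D where "D = (\<lambda>s. s ^ Suc k / fact (Suc k) * exp (\<omega> * s) - s ^ Suc k * varphi (Suc k) (\<omega> * s))"
  have "D 0 \<le> D s"
  proof (rule DERIV_nonneg_imp_nondecreasing[OF \<open>s \<ge> 0\<close>])
    fix x :: real assume x: "0 \<le> x"
    have "(D has_real_derivative x ^ k / fact k * exp (\<omega> * x)
        + x ^ Suc k / fact (Suc k) * (exp (\<omega> * x) * \<omega>) - x ^ k * varphi k (\<omega> * x)) (at x)"
      unfolding D_def
      by (rule derivative_eq_intros power_div_fact_has_derivative power_mult_varphi_has_derivative refl)+ simp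
    \<comment> \<open>The product rule on the right-hand side leaves this extra term; its sign is in
      favour of the inequality.\<close>
    moreover have "x ^ Suc k / fact (Suc k) * (exp (\<omega> * x) * \<omega>) \<ge> 0"
      using x \<open>\<omega> \<ge> 0\<close> by simp
    ultimately show "\<exists>y. DERIV D x :> y \<and> 0 \<le> y"
      using Suc.IH[OF x] by (smt (verit))
  qed
  then show ?case
    by (simp add: D_def del: varphi.simps)
qed

section \<open>The matrix exponential as a family of scalar power series\<close>

lemma matrix_power_Suc_right: "matrix_power A (Suc m) = matrix_power A m ** A"
proof (induction m)
  case (Suc m)
  have "matrix_power A (Suc (Suc m)) = A ** matrix_power A (Suc m)"
    by (simp add: matrix_power_def)
  also have "\<dots> = (A ** matrix_power A m) ** A"
    by (simp add: Suc matrix_mul_assoc)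
  finally show ?case
    by (simp add: matrix_power_def)
qed (simp add: matrix_power_def)

lemma matrix_power_scaleR: "matrix_power (c *\<^sub>R A) m = c ^ m *\<^sub>R matrix_power A m"
proof (induction m)
  case (Suc m)
  have "matrix_power (c *\<^sub>R A) (Suc m) = (c *\<^sub>R A) ** matrix_power (c *\<^sub>R A) m"
    by (simp add: matrix_power_def)
  also have "\<dots> = c ^ Suc m *\<^sub>R (A ** matrix_power A m)"
    unfolding Suc by (simp add: vec_eq_iff matrix_matrix_mult_def sum_distrib_left mult_ac)
  finally show ?case
    by (simp add: matrix_power_def)
qed (simp add: matrix_power_def)

text \<open>The sum of the absolute values of all entries dominates each row sum, so each further
  factor \<open>A\<close> costs at most one factor of it. This geometric growth is what the
  comparison with the exponential series needs.\<close>

lemma matrix_power_entry_le: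
  fixes A :: "real ^ 'n ^ 'n"
  shows "\<bar>matrix_power A m $ i $ j\<bar> \<le> (\<Sum>i\<in>UNIV. \<Sum>l\<in>UNIV. \<bar>A $ i $ l\<bar>) ^ m"
proof (induction m arbitrary: i j)
  case 0
  show ?case by (simp add: matrix_power_def mat_def)
next
  case (Suc m)
  let ?K = "\<Sum>i\<in>UNIV. \<Sum>l\<in>UNIV. \<bar>A $ i $ l\<bar>"
  have "?K \<ge> 0"
    by (intro sum_nonneg) simp
  have "\<bar>matrix_power A (Suc m) $ i $ j\<bar> = \<bar>\<Sum>l\<in>UNIV. A $ i $ l * matrix_power A m $ l $ j\<bar>"
    by (simp add: matrix_power_def matrix_matrix_mult_def)
  also have "\<dots> \<le> (\<Sum>l\<in>UNIV. \<bar>A $ i $ l\<bar> * ?K ^ m)"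
    by (rule order_trans[OF sum_abs]) (auto simp: abs_mult intro!: sum_mono mult_left_mono Suc)
  also have "\<dots> = (\<Sum>l\<in>UNIV. \<bar>A $ i $ l\<bar>) * ?K ^ m"
    by (simp add: sum_distrib_right)
  also have "\<dots> \<le> ?K * ?K ^ m"
    using \<open>?K \<ge> 0\<close>
    by (intro mult_right_mono member_le_sum[of i UNIV "\<lambda>i. \<Sum>l\<in>UNIV. \<bar>A $ i $ l\<bar>"] sum_nonneg) auto
  finally show ?case by simp
qed

lemma summable_matrix_power_entry:
  fixes A :: "real ^ 'n ^ 'n"
  shows "summable (\<lambda>m. matrix_power A m $ i $ j / fact m * s ^ m)"
proof (rule summable_comparison_test')
  let ?K = "\<Sum>i\<in>UNIV. \<Sum>l\<in>UNIV. \<bar>A $ i $ l\<bar>"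
  show "summable (\<lambda>m. inverse (fact m) * (?K * \<bar>s\<bar>) ^ m)"
    by (rule summable_exp)
  show "norm (matrix_power A m $ i $ j / fact m * s ^ m) \<le> inverse (fact m) * (?K * \<bar>s\<bar>) ^ m"
    if "m \<ge> 0" for m
    using mult_right_mono[OF matrix_power_entry_le[of A m i j], of "\<bar>s\<bar> ^ m / fact m"]
    by (simp add: abs_mult power_abs power_mult_distrib field_simps)
qed

text \<open>Convergence of matrices is entrywise. Each entry becomes a scalar power series in
  \<open>s\<close>, to which the calculus of real power series applies.\<close>

lemma matrix_exp_entry:
  fixes A :: "real ^ 'n ^ 'n"
  shows "matrix_exp (s *\<^sub>R A) $ i $ j = (\<Sum>m. matrix_power A m $ i $ j / fact m * s ^ m)"
proof -
  have "(\<lambda>m. (1 / fact m) *\<^sub>R matrix_power (s *\<^sub>R A) m) sums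
      (\<chi> i j. \<Sum>m. matrix_power A m $ i $ j / fact m * s ^ m)"
    unfolding sums_def
  proof (intro vec_tendstoI)
    fix i j
    have "(\<lambda>m. matrix_power A m $ i $ j / fact m * s ^ m) sums
        (\<Sum>m. matrix_power A m $ i $ j / fact m * s ^ m)"
      by (rule summable_sums[OF summable_matrix_power_entry])
    then show "(\<lambda>n. (\<Sum>m<n. (1 / fact m) *\<^sub>R matrix_power (s *\<^sub>R A) m) $ i $ j) \<longlonglongrightarrow>
        (\<chi> i j. \<Sum>m. matrix_power A m $ i $ j / fact m * s ^ m) $ i $ j"
      by (simp add: sums_def matrix_power_scaleR mult.commute)
  qed
  then show ?thesis
    by (simp add: matrix_exp_def sums_unique[symmetric])
qed

lemma matrix_exp_0: "matrix_exp (0 :: real ^ 'n ^ 'n) = mat 1"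
proof -
  \<comment> \<open>Writing the zero matrix as a multiple makes the entry formula applicable; at
    argument 0 only the constant coefficient survives.\<close>
  have "matrix_exp (0 *\<^sub>R (0 :: real ^ 'n ^ 'n)) $ i $ j = mat 1 $ i $ j" for i j
    unfolding matrix_exp_entry powser_zero by (simp add: matrix_power_def)
  then show ?thesis by (simp add: vec_eq_iff)
qed

text \<open>The series may be differentiated term by term because it converges everywhere.\<close>

lemma matrix_exp_entry_has_derivative:
  fixes A :: "real ^ 'n ^ 'n"
  shows "((\<lambda>s. matrix_exp (s *\<^sub>R A) $ i $ j) has_real_derivative
      (matrix_exp (s *\<^sub>R A) ** A) $ i $ j) (at s)"
proof -
  let ?c = "\<lambda>i j m. matrix_power A m $ i $ j / fact m"
  have "((\<lambda>s. \<Sum>m. ?c i j m * s ^ m) has_real_derivative (\<Sum>m. diffs (?c i j) m * s ^ m)) (at s)"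
    by (rule termdiffs_strong_converges_everywhere) (rule summable_matrix_power_entry)
  moreover have "(\<Sum>m. diffs (?c i j) m * s ^ m) = (matrix_exp (s *\<^sub>R A) ** A) $ i $ j"
  proof -
    have "diffs (?c i j) m * s ^ m = (\<Sum>l\<in>UNIV. ?c i l m * s ^ m * A $ l $ j)" for m
    proof -
      \<comment> \<open>The factor \<open>Suc m\<close> from differentiation cancels against the
        factorial. Splitting the next power with \<open>A\<close> on the right then produces the
        product with \<open>A\<close> on that side.\<close>
      have "diffs (?c i j) m = matrix_power A (Suc m) $ i $ j / fact m"
        by (simp add: diffs_def fact_Suc del: of_nat_Suc)
      then show ?thesis
        by (simp add: matrix_power_Suc_right matrix_matrix_mult_def sum_distrib_left
            sum_divide_distrib mult_ac)
    qed
    then have "(\<Sum>m. diffs (?c i j) m * s ^ m) = (\<Sum>m. \<Sum>l\<in>UNIV. ?c i l m * s ^ m * A $ l $ j)"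
      by simp
    also have "\<dots> = (\<Sum>l\<in>UNIV. \<Sum>m. ?c i l m * s ^ m * A $ l $ j)"
      by (intro suminf_sum summable_mult2 summable_matrix_power_entry)
    also have "\<dots> = (\<Sum>l\<in>UNIV. (\<Sum>m. ?c i l m * s ^ m) * A $ l $ j)"
      by (intro sum.cong refl suminf_mult2[symmetric] summable_matrix_power_entry)
    finally show ?thesis
      by (simp add: matrix_matrix_mult_def matrix_exp_entry)
  qed
  ultimately show ?thesis
    by (simp add: matrix_exp_entry)
qed

section \<open>The exponential as an integrating factor\<close>

lemma has_vector_derivative_vec:
  fixes f :: "real \<Rightarrow> real ^ 'n"
  assumes "\<And>i. ((\<lambda>s. f s $ i) has_real_derivative f' $ i) (at s within S)"
  shows "(f has_vector_derivative f') (at s within S)"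
  unfolding has_vector_derivative_def
proof (subst has_derivative_componentwise_within, rule ballI)
  fix b :: "real ^ 'n"
  assume "b \<in> Basis"
  then obtain i where "b = axis i 1"
    by (auto simp: Basis_vec_def)
  then show "((\<lambda>s. inner (f s) b) has_derivative (\<lambda>x. inner (x *\<^sub>R f') b)) (at s within S)"
    using assms[of i] by (simp add: inner_axis has_field_derivative_def mult.commute[of _ "f' $ i"])
qed

lemma has_vector_derivative_vec_nth:
  fixes f :: "real \<Rightarrow> real ^ 'n"
  assumes "(f has_vector_derivative f') (at s within S)"
  shows "((\<lambda>s. f s $ i) has_real_derivative f' $ i) (at s within S)"
  unfolding has_real_derivative_iff_has_vector_derivative
  using bounded_linear.has_vector_derivative[OF bounded_linear_vec_nth assms] .

text \<open>In the product rule, the term with \<open>A\<close> from the exponential cancels the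
  linear term of the equation for \<open>e\<close>. This is variation of constants in differential
  form.\<close>

lemma matrix_exp_mult_has_vector_derivative:
  fixes A :: "real ^ 'n ^ 'n" and e :: "real \<Rightarrow> real ^ 'n"
  assumes e: "(e has_vector_derivative - (A *v e s) + h) (at s within S)"
  shows "((\<lambda>s. matrix_exp (- ((t - s) *\<^sub>R A)) *v e s) has_vector_derivative
      matrix_exp (- ((t - s) *\<^sub>R A)) *v h) (at s within S)"
proof (rule has_vector_derivative_vec)
  fix i
  define E where "E = (\<lambda>s. matrix_exp ((s - t) *\<^sub>R A))"
  \<comment> \<open>The sign is absorbed into the scalar, giving the power series in
    \<open>A\<close> shifted by \<open>t\<close>, whose inner derivative is 1.\<close>
  have E: "matrix_exp (- ((t - s) *\<^sub>R A)) = E s" for s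
    by (simp add: E_def flip: scaleR_minus_left)
  have E_deriv: "((\<lambda>s. E s $ i $ j) has_real_derivative (E s ** A) $ i $ j) (at s within S)" for j
  proof -
    have "((\<lambda>s. matrix_exp (s *\<^sub>R A) $ i $ j) has_real_derivative
        (E s ** A) $ i $ j) (at (s - t))"
      unfolding E_def by (rule matrix_exp_entry_has_derivative)
    then have "(((\<lambda>s. matrix_exp (s *\<^sub>R A) $ i $ j) \<circ> (\<lambda>s. s - t)) has_real_derivative
        (E s ** A) $ i $ j * 1) (at s within S)"
      by (rule DERIV_chain) (auto intro!: derivative_eq_intros)
    then show ?thesis by (simp add: E_def o_def)
  qed
  have "((\<lambda>s. \<Sum>j\<in>UNIV. E s $ i $ j * e s $ j) has_real_derivative
      (\<Sum>j\<in>UNIV. (E s ** A) $ i $ j * e s $ j + (- (A *v e s) + h) $ j * E s $ i $ j)) (at s within S)"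
    by (intro DERIV_sum DERIV_mult E_deriv has_vector_derivative_vec_nth[OF e])
  moreover have "(\<Sum>j\<in>UNIV. (E s ** A) $ i $ j * e s $ j + (- (A *v e s) + h) $ j * E s $ i $ j) =
      (((E s ** A) *v e s) + E s *v (- (A *v e s) + h)) $ i"
    by (simp add: matrix_vector_mult_def sum.distrib mult.commute)
  also have "((E s ** A) *v e s) + E s *v (- (A *v e s) + h) = E s *v h"
    by (simp add: matrix_vector_right_distrib matrix_vector_mul_assoc[symmetric]
        matrix_vector_mult_diff_distrib)
  finally show "((\<lambda>s. (matrix_exp (- ((t - s) *\<^sub>R A)) *v e s) $ i) has_real_derivative
      (matrix_exp (- ((t - s) *\<^sub>R A)) *v h) $ i) (at s within S)"
    unfolding E by (simp add: matrix_vector_mult_def)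
qed

section \<open>Vector norms on complex space and their induced matrix norms\<close>

context
  fixes nrm :: "complex ^ 'n \<Rightarrow> real"
  assumes nrm: "vector_norm nrm"
begin

lemma vector_norm_0_iff: "nrm x = 0 \<longleftrightarrow> x = 0"
  using nrm by (simp add: vector_norm_def)

lemma vector_norm_scale: "nrm (c *s x) = cmod c * nrm x"
  using nrm by (simp add: vector_norm_def)

lemma vector_norm_triangle: "nrm (x + y) \<le> nrm x + nrm y"
  using nrm by (simp add: vector_norm_def)

lemma vector_norm_minus: "nrm (- x) = nrm x"
  using vector_norm_scale[of "-1" x] by (simp add: vector_sneg_minus1[symmetric])

lemma vector_norm_nonneg: "nrm x \<ge> 0"
  using vector_norm_triangle[of x "- x"] vector_norm_minus[of x] vector_norm_0_iff[of 0] by simp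

text \<open>Expansion in the unit vectors and the triangle inequality give one half of the
  equivalence with the Euclidean norm.\<close>

lemma vector_norm_le_norm:
  obtains K where "K > 0" "\<And>x. nrm x \<le> K * norm x"
proof
  let ?K = "\<Sum>i\<in>UNIV. nrm (axis i 1)"
  \<comment> \<open>Adding 1 makes strict positivity of the constant immediate from nonnegativity of
    the sum.\<close>
  show "?K + 1 > 0"
    using vector_norm_nonneg by (simp add: add_nonneg_pos sum_nonneg)
  fix x
  have sum_le: "nrm (\<Sum>i\<in>S. g i) \<le> (\<Sum>i\<in>S. nrm (g i))" if "finite S"
    for S :: "'n set" and g
    using that
  proof (induction S rule: finite_induct)
    case (insert i S)
    then show ?case
      using vector_norm_triangle[of "g i" "sum g S"] by simp
  qed (use vector_norm_0_iff[of 0] in simp)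
  have "nrm x = nrm (\<Sum>i\<in>UNIV. x $ i *s axis i 1)"
    by (simp add: basis_expansion)
  also have "\<dots> \<le> (\<Sum>i\<in>UNIV. cmod (x $ i) * nrm (axis i 1))"
    using sum_le[of UNIV "\<lambda>i. x $ i *s axis i 1"] by (simp add: vector_norm_scale)
  also have "\<dots> \<le> (\<Sum>i\<in>UNIV. norm x * nrm (axis i 1))"
    by (intro sum_mono mult_right_mono vector_norm_nonneg Finite_Cartesian_Product.norm_nth_le)
  also have "\<dots> = ?K * norm x"
    by (simp add: sum_distrib_left mult.commute)
  also have "\<dots> \<le> (?K + 1) * norm x"
    by (intro mult_right_mono) auto
  finally show "nrm x \<le> (?K + 1) * norm x" .
qed

text \<open>The reverse triangle inequality and the upper bound by the Euclidean norm make
  \<open>nrm\<close> Lipschitz.\<close>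

lemma continuous_on_vector_norm: "continuous_on UNIV nrm"
proof -
  obtain K where K: "K > 0" "\<And>x. nrm x \<le> K * norm x"
    using vector_norm_le_norm by blast
  have "dist (nrm x) (nrm y) \<le> K * dist x y" for x y
  proof -
    have "nrm (x - y) = nrm (y - x)"
      using vector_norm_minus[of "x - y"] by simp
    then show ?thesis
      using vector_norm_triangle[of "x - y" y] vector_norm_triangle[of "y - x" x] K(2)[of "x - y"]
      by (simp add: dist_norm abs_le_iff)
  qed
  then have "K-lipschitz_on UNIV nrm"
    using \<open>K > 0\<close> by (intro lipschitz_onI) auto
  then show ?thesis
    by (rule lipschitz_on_continuous_on)
qed

text \<open>The other half of the equivalence: by compactness \<open>nrm\<close> attains a minimum
  on the Euclidean unit sphere; it is positive, and homogeneity extends the bound to all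
  vectors.\<close>

lemma norm_le_vector_norm:
  obtains K where "K > 0" "\<And>x. K * norm x \<le> nrm x"
proof -
  let ?S = "sphere (0 :: complex ^ 'n) 1"
  have "continuous_on ?S nrm"
    using continuous_on_vector_norm continuous_on_subset by blast
  \<comment> \<open>Any unit vector shows that the sphere is nonempty.\<close>
  moreover have "axis undefined 1 \<in> ?S"
    by (simp add: norm_axis_1)
  ultimately obtain z where z: "z \<in> ?S" "\<And>x. x \<in> ?S \<Longrightarrow> nrm z \<le> nrm x"
    using continuous_attains_inf[of ?S nrm] by auto
  show ?thesis
  proof
    show "nrm z > 0"
      using z(1) vector_norm_0_iff[of z] vector_norm_nonneg[of z] by (cases "z = 0") auto
    show "nrm z * norm x \<le> nrm x" for x
    proof (cases "x = 0")
      case False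
      let ?u = "complex_of_real (1 / norm x) *s x"
      \<comment> \<open>\<open>nrm\<close> is homogeneous for the complex scaling \<open>*s\<close>,
        the Euclidean norm is used with real scaling; here the two agree.\<close>
      have "?u = (1 / norm x) *\<^sub>R x"
        by (simp add: vec_eq_iff scaleR_conv_of_real[where 'a = complex])
      then have "?u \<in> ?S"
        using False by simp
      from z(2)[OF this] show ?thesis
        using False unfolding vector_norm_scale by (simp add: field_simps norm_divide)
    qed (simp add: vector_norm_nonneg)
  qed
qed

text \<open>The two norm comparisons and boundedness of the linear map bound the quotients from
  above, so the supremum really dominates each of them.\<close>

lemma induced_norm_bound: "nrm (M *v x) \<le> induced_norm nrm M * nrm x"
proof (cases "x = 0")
  case True
  then show ?thesis
    using vector_norm_0_iff[of 0] by simp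
next
  case False
  obtain K where K: "K > 0" "\<And>x. nrm x \<le> K * norm x"
    using vector_norm_le_norm by blast
  obtain k where k: "k > 0" "\<And>x. k * norm x \<le> nrm x"
    using norm_le_vector_norm by blast
  have "bounded_linear ((*v) M)"
    by (rule matrix_vector_mul_bounded_linear)
  then obtain B where B: "B > 0" "\<And>x. norm (M *v x) \<le> norm x * B"
    using bounded_linear.pos_bounded by blast
  have pos: "nrm x > 0" if "x \<noteq> 0" for x
    using that vector_norm_0_iff[of x] vector_norm_nonneg[of x] by simp
  have "nrm (M *v x) / nrm x \<le> K * B / k" if "x \<noteq> 0" for x
  proof -
    have "nrm (M *v x) \<le> K * norm (M *v x)"
      by (rule K)
    also have "\<dots> \<le> K * (norm x * B)"
      using K(1) B(2) by (intro mult_left_mono) auto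
    also have "\<dots> = K * B / k * (k * norm x)"
      using k(1) by simp
    also have "\<dots> \<le> K * B / k * nrm x"
      using K(1) B(1) k by (intro mult_left_mono) auto
    finally show ?thesis
      using pos[OF that] by (simp add: pos_divide_le_eq)
  qed
  then have "bdd_above ((\<lambda>x. nrm (M *v x) / nrm x) ` {x. x \<noteq> 0})"
    by (auto intro!: bdd_aboveI[of _ "K * B / k"])
  then have "nrm (M *v x) / nrm x \<le> induced_norm nrm M"
    unfolding induced_norm_def using False by (intro cSUP_upper) auto
  then show ?thesis
    using pos[OF False] by (simp add: pos_divide_le_eq)
qed

end

section \<open>Real vectors and matrices inside complex space\<close>

lemma cvec_simps:
  "cvec (x + y) = cvec x + cvec y" "cvec (r *\<^sub>R x) = complex_of_real r *s cvec x"
  by (simp_all add: cvec_def vec_eq_iff)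

text \<open>This transfers a bound on the complex induced norm to the action of a real matrix on
  real vectors.\<close>

lemma cmat_mult_cvec: "cmat M *v cvec x = cvec (M *v x)"
  by (simp add: cvec_def vec_eq_iff matrix_vector_mult_def map_matrix_def)

lemma continuous_on_cvec: "continuous_on UNIV cvec"
  unfolding cvec_def by (intro continuous_intros)

section \<open>Error estimate for the waveform relaxation\<close>

theorem proposition2:
  fixes \<Phi> :: "real \<Rightarrow> real ^ 'n \<Rightarrow> real ^ 'n"
    and v :: "real ^ 'n"
    and T L C \<omega> :: real
    and nrm :: "complex ^ 'n \<Rightarrow> real"
    and A :: "nat \<Rightarrow> real ^ 'n ^ 'n"
    and f :: "nat \<Rightarrow> real ^ 'n \<Rightarrow> real ^ 'n"
    and g :: "real \<Rightarrow> real ^ 'n"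
    and y :: "real \<Rightarrow> real ^ 'n"
    and yit :: "nat \<Rightarrow> real \<Rightarrow> real ^ 'n"
  assumes norm: "vector_norm nrm"
    and T: "T > 0"
    and sol: "\<And>t. t \<in> {0..T} \<Longrightarrow>
          (y has_vector_derivative \<Phi> t (y t)) (at t within {0..T})"
    and sol_init: "y 0 = v"
    and splitting: "\<And>k t u. t \<ge> 0 \<Longrightarrow> \<Phi> t u = - (A k *v u) + f k u + g t"
    and lipschitz: "\<And>k u w. nrm (cvec (f k u - f k w)) \<le> L * nrm (cvec (u - w))"
    and C: "C > 0" and \<omega>: "\<omega> \<ge> 0"
    and exp_bound: "\<And>k t. t \<ge> 0 \<Longrightarrow>
          induced_norm nrm (cmat (matrix_exp (- (t *\<^sub>R A k)))) \<le> C * exp (- (\<omega> * t))"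
    and init_cont: "continuous_on {0..T} (yit 0)"
    and init: "yit 0 0 = v"
    and iter: "\<And>k t. t \<in> {0..T} \<Longrightarrow>
          (yit (Suc k) has_vector_derivative
             (- (A k *v yit (Suc k) t) + f k (yit k t) + g t)) (at t within {0..T})"
    and iter_init: "\<And>k. yit (Suc k) 0 = v"
  shows "\<forall>k\<ge>1. \<forall>t\<in>{0..T}.
      nrm (cvec (y t - yit k t))
        \<le> (C * L) ^ k * t ^ k * exp (- (\<omega> * t)) * varphi k (\<omega> * t)
            * (SUP s\<in>{0..t}. nrm (cvec (y s - yit 0 s)))
    \<and> (C * L) ^ k * t ^ k * exp (- (\<omega> * t)) * varphi k (\<omega> * t)
            * (SUP s\<in>{0..t}. nrm (cvec (y s - yit 0 s)))
        \<le> (C * L) ^ k * (t ^ k / fact k)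
            * (SUP s\<in>{0..t}. nrm (cvec (y s - yit 0 s)))"
proof -
  define p where "p = (\<lambda>x. nrm (cvec x))"
  have p_cont: "continuous_on UNIV p"
    unfolding p_def
    by (rule continuous_on_compose2[OF continuous_on_vector_norm[OF norm] continuous_on_cvec]) simp
  have p_add: "p (x + z) \<le> p x + p z" for x z
    by (simp add: p_def cvec_simps vector_norm_triangle[OF norm])
  have p_scale: "p (r *\<^sub>R x) = r * p x" if "r \<ge> 0" for r x
    using that by (simp add: p_def cvec_simps vector_norm_scale[OF norm])
  have p_nonneg: "p x \<ge> 0" for x
    by (simp add: p_def vector_norm_nonneg[OF norm])
  have p_mult: "p (M *v x) \<le> induced_norm nrm (cmat M) * p x" for M x
    using induced_norm_bound[OF norm, of "cmat M" "cvec x"] by (simp add: p_def cmat_mult_cvec)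
  have lip: "p (f k u - f k w) \<le> L * p (u - w)" for k u w
    using lipschitz by (simp add: p_def)
  \<comment> \<open>The sign of \<open>L\<close> follows from the Lipschitz bound itself, applied to
    the all-ones vector and the origin.\<close>
  have "L \<ge> 0"
  proof -
    have "cvec (1 :: real ^ 'n) \<noteq> 0"
      by (simp add: cvec_def vec_eq_iff)
    then have "p 1 > 0"
      using p_nonneg[of 1] vector_norm_0_iff[OF norm] by (simp add: p_def less_le)
    moreover have "0 \<le> L * p (1 - 0)"
      by (rule order_trans[OF p_nonneg lip[of 0 1 0]])
    ultimately show ?thesis
      by (simp add: zero_le_mult_iff)
  qed
  define e where "e = (\<lambda>k t. y t - yit k t)"
  define M where "M = (\<lambda>t. SUP s\<in>{0..t}. p (e 0 s))"
  have y_cont: "continuous_on {0..T} y"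
    using sol has_vector_derivative_continuous continuous_on_eq_continuous_within by blast
  \<comment> \<open>Continuity of the initial error on a compact interval makes the supremum an
    upper bound.\<close>
  have M: "p (e 0 s) \<le> M t" if "s \<in> {0..t}" "t \<in> {0..T}" for s t
  proof -
    have "continuous_on {0..t} (\<lambda>s. p (e 0 s))"
      unfolding e_def using that(2)
      by (intro continuous_on_compose2[OF p_cont] continuous_on_diff
          continuous_on_subset[OF y_cont] continuous_on_subset[OF init_cont]) auto
    then have "bdd_above ((\<lambda>s. p (e 0 s)) ` {0..t})"
      by (intro bounded_imp_bdd_above compact_imp_bounded compact_continuous_image) auto
    then show ?thesis
      unfolding M_def using that(1) by (rule cSUP_upper[rotated])
  qed
  \<comment> \<open>The right-hand side at \<open>y\<close> is split with the same index
    \<open>k\<close> as the iteration step, so \<open>g\<close> cancels.\<close>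
  have e_deriv: "(e (Suc k) has_vector_derivative
      - (A k *v e (Suc k) t) + (f k (y t) - f k (yit k t))) (at t within {0..T})"
    if "t \<in> {0..T}" for k t
  proof -
    have "(e (Suc k) has_vector_derivative
        \<Phi> t (y t) - (- (A k *v yit (Suc k) t) + f k (yit k t) + g t)) (at t within {0..T})"
      unfolding e_def by (intro has_vector_derivative_diff sol iter that)
    moreover have "\<Phi> t (y t) = - (A k *v y t) + f k (y t) + g t"
      using that by (intro splitting) simp
    ultimately show ?thesis
      by (simp add: e_def matrix_vector_mult_diff_distrib algebra_simps)
  qed
  \<comment> \<open>The maximum is taken at a fixed \<open>t\<close> while \<open>s\<close> varies
    below it. It is thus a constant under differentiation, and the hypothesis is available at every
    earlier time. The induction starts at \<open>k = 0\<close>, where the two exponentials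
    cancel.\<close>
  have main: "p (e k s) \<le> (C * L) ^ k * s ^ k * exp (- (\<omega> * s)) * varphi k (\<omega> * s) * M t"
    if t: "t \<in> {0..T}" and s: "s \<in> {0..t}" for k s t
    using s
  proof (induction k arbitrary: s)
    case 0
    then show ?case
      using M[OF 0 t] by (simp flip: exp_add)
  next
    case (Suc k)
    define w where "w = (\<lambda>r. matrix_exp (- ((s - r) *\<^sub>R A k)) *v e (Suc k) r)"
    \<comment> \<open>The decay factor is frozen at the endpoint \<open>s\<close>: propagation from
      \<open>r\<close> to \<open>s\<close> and the decay up to \<open>r\<close> combine to a factor
      independent of \<open>r\<close>.\<close>
    define \<psi> where "\<psi> = (\<lambda>r. ((C * L) ^ Suc k * exp (- (\<omega> * s)) * M t) *
        (r ^ Suc k * varphi (Suc k) (\<omega> * r)))"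
    have "p (w s - w 0) \<le> \<psi> s - \<psi> 0"
    proof (rule seminorm_mean_value_le[OF p_cont p_add p_scale])
      show "0 \<le> s" using Suc by simp
      fix r assume r: "r \<in> {0..s}"
      then have rT: "r \<in> {0..T}" and rt: "r \<in> {0..t}" using Suc.prems t by auto
      show "(w has_vector_derivative matrix_exp (- ((s - r) *\<^sub>R A k)) *v
          (f k (y r) - f k (yit k r))) (at r within {0..s})"
        unfolding w_def using Suc.prems t
        by (intro matrix_exp_mult_has_vector_derivative
            has_vector_derivative_within_subset[OF e_deriv[OF rT]]) auto
      show "(\<psi> has_real_derivative ((C * L) ^ Suc k * exp (- (\<omega> * s)) * M t) *
          (r ^ k * varphi k (\<omega> * r))) (at r within {0..s})"
        unfolding \<psi>_def by (intro DERIV_cmult power_mult_varphi_has_derivative)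
      have "p (matrix_exp (- ((s - r) *\<^sub>R A k)) *v (f k (y r) - f k (yit k r))) \<le>
          (C * exp (- (\<omega> * (s - r)))) * p (f k (y r) - f k (yit k r))"
        using r by (intro order_trans[OF p_mult] mult_right_mono exp_bound p_nonneg) auto
      also have "\<dots> \<le> (C * exp (- (\<omega> * (s - r)))) * (L * p (e k r))"
        using C lip[of k "y r" "yit k r"] by (intro mult_left_mono) (auto simp: e_def)
      also have "\<dots> \<le> (C * exp (- (\<omega> * (s - r)))) *
          (L * ((C * L) ^ k * r ^ k * exp (- (\<omega> * r)) * varphi k (\<omega> * r) * M t))"
        using C \<open>L \<ge> 0\<close> by (intro mult_left_mono Suc.IH rt) auto
      also have "\<dots> = (C * L) ^ Suc k * (exp (- (\<omega> * (s - r))) * exp (- (\<omega> * r))) * M t *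
          (r ^ k * varphi k (\<omega> * r))"
        by simp
      also have "exp (- (\<omega> * (s - r))) * exp (- (\<omega> * r)) = exp (- (\<omega> * s))"
        by (simp add: algebra_simps flip: exp_add)
      finally show "p (matrix_exp (- ((s - r) *\<^sub>R A k)) *v (f k (y r) - f k (yit k r))) \<le>
          (C * L) ^ Suc k * exp (- (\<omega> * s)) * M t * (r ^ k * varphi k (\<omega> * r))" .
    qed
    moreover have "w 0 = 0"
      by (simp add: w_def e_def sol_init iter_init)
    moreover have "w s = e (Suc k) s"
      by (simp add: w_def matrix_exp_0)
    ultimately show ?case
      by (simp add: \<psi>_def mult_ac del: varphi.simps)
  qed
  have weight: "(C * L) ^ k * t ^ k * exp (- (\<omega> * t)) * varphi k (\<omega> * t) * M t
      \<le> (C * L) ^ k * (t ^ k / fact k) * M t" if t: "t \<in> {0..T}" for k t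
  proof -
    have "M t \<ge> 0"
      using order_trans[OF p_nonneg M[of 0 t]] t by simp
    have "exp (- (\<omega> * t)) * (t ^ k * varphi k (\<omega> * t)) \<le>
        exp (- (\<omega> * t)) * (t ^ k / fact k * exp (\<omega> * t))"
      using \<omega> t by (intro mult_left_mono power_mult_varphi_le) auto
    also have "\<dots> = t ^ k / fact k"
      by (simp add: exp_minus)
    finally have "(C * L) ^ k * (exp (- (\<omega> * t)) * (t ^ k * varphi k (\<omega> * t))) * M t
        \<le> (C * L) ^ k * (t ^ k / fact k) * M t"
      using C \<open>L \<ge> 0\<close> \<open>M t \<ge> 0\<close> by (intro mult_right_mono mult_left_mono) auto
    then show ?thesis
      by (simp add: mult_ac)
  qed
  \<comment> \<open>The first estimate is \<open>main\<close> at \<open>s = t\<close>.\<close>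
  show ?thesis
    using main weight by (auto simp: M_def e_def p_def)
qed

end
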